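(* Let $\bm{B},\bm{C}$ be real symmetric positive semi-definite $N\times N$ matrices with $\bm{B}+\bm{C}$ positive definite, let $\bm{A}=\bm{B}+i\bm{C}$, $\bm{P}=(1+i)(\bm{B}+\bm{C})$ and $\bm{Q}=\bm{C}+i\bm{B}$, so that $\bm{A}=\bm{P}-\bm{Q}$. For $n\ge1$ let $\bm{\mathcal{P}}_n$ be the matrix defined by $$\bm{\mathcal{P}}_n^{-1}=\left(\bm{I}+\bm{P}^{-1}\bm{Q}+(\bm{P}^{-1}\bm{Q})^2+\cdots+(\bm{P}^{-1}\bm{Q})^{n-1}\right)\bm{P}^{-1}.$$ Then there exists a matrix norm $|||\cdot|||$ such that the condition number of $\bm{\mathcal{P}}_n^{-1}\bm{A}$ with respect to this norm satisfies, for all $n\ge 1$, $$\kappa(\bm{\mathcal{P}}_n^{-1}\bm{A})\le\frac{1+0.8^n}{1-0.8^n}\le 9.$$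
   Context: $i$ is the imaginary unit. A matrix norm means a submultiplicative norm on complex $N\times N$ matrices, and $\kappa(\bm{M})=|||\bm{M}|||\;|||\bm{M}^{-1}|||$. *)

theory Defs
  imports "HOL-Analysis.Analysis"
begin

definition pos_semidef :: "real^'n^'n \<Rightarrow> bool" where
  "pos_semidef M \<longleftrightarrow> transpose M = M \<and> (\<forall>x. 0 \<le> x \<bullet> (M *v x))"

definition pos_def :: "real^'n^'n \<Rightarrow> bool" where
  "pos_def M \<longleftrightarrow> transpose M = M \<and> (\<forall>x. x \<noteq> 0 \<longrightarrow> 0 < x \<bullet> (M *v x))"

definition cmat :: "real^'n^'m \<Rightarrow> complex^'n^'m" where
  "cmat M = map_matrix complex_of_real M"

definition cscale :: "complex \<Rightarrow> complex^'n^'m \<Rightarrow> complex^'n^'m" (infixr \<open>*\<^sub>C\<close> 75) where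
  "c *\<^sub>C M = map_matrix (\<lambda>z. c * z) M"

text \<open>The class operations \<open>*\<close> and \<open>^\<close> on type \<open>vec\<close> act entrywise, hence a separate power
  for the matrix product.\<close>

primrec matpow :: "complex^'n^'n \<Rightarrow> nat \<Rightarrow> complex^'n^'n" where
  "matpow M 0 = mat 1"
| "matpow M (Suc k) = M ** matpow M k"

definition matrix_norm :: "(complex^'n^'n \<Rightarrow> real) \<Rightarrow> bool" where
  "matrix_norm N \<longleftrightarrow>
     (\<forall>X. 0 \<le> N X) \<and>
     (\<forall>X. N X = 0 \<longleftrightarrow> X = 0) \<and>
     (\<forall>c X. N (c *\<^sub>C X) = cmod c * N X) \<and>
     (\<forall>X Y. N (X + Y) \<le> N X + N Y) \<and>
     (\<forall>X Y. N (X ** Y) \<le> N X * N Y)"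

text \<open>\<open>matrix_inv\<close> is unspecified on singular matrices, so this is meaningful for
  invertible \<open>M\<close> only.\<close>

definition cond_num :: "(complex^'n^'n \<Rightarrow> real) \<Rightarrow> complex^'n^'n \<Rightarrow> real" where
  "cond_num N M = N M * N (matrix_inv M)"

definition neumann_sum :: "complex^'n^'n \<Rightarrow> complex^'n^'n \<Rightarrow> nat \<Rightarrow> complex^'n^'n" where
  "neumann_sum P Q n = (\<Sum>k<n. matpow (matrix_inv P ** Q) k) ** matrix_inv P"

text \<open>The preconditioner is given through its inverse, which is the Neumann sum; this needs
  the Neumann sum to be invertible.\<close>

definition precond :: "complex^'n^'n \<Rightarrow> complex^'n^'n \<Rightarrow> nat \<Rightarrow> complex^'n^'n" where
  "precond P Q n = matrix_inv (neumann_sum P Q n)"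

end

theory Submission
  imports Defs
begin

text \<open>
  The splitting is \<open>A = P (I - G)\<close> with \<open>G = P\<^sup>-\<^sup>1 Q\<close>, and the Neumann sum telescopes:
  \<open>(I + G + \<dots> + G\<^sup>n\<^sup>-\<^sup>1) P\<^sup>-\<^sup>1 A = I - G\<^sup>n\<close>. If some vector norm satisfies
  \<open>\<nu> (G x) \<le> r \<nu> x\<close> with \<open>r < 1\<close>, then in the induced operator norm \<open>I - G\<^sup>n\<close> has norm at most
  \<open>1 + r\<^sup>n\<close> and its inverse at most \<open>1 / (1 - r\<^sup>n)\<close>; this is \<open>near_identity\<close>. So everything
  rests on a norm in which \<open>G\<close> contracts by \<open>0.8\<close>.

  Put \<open>S = B + C\<close> and \<open>T = S\<^sup>-\<^sup>1 C\<close>. In the energy inner product \<open>\<langle>x, y\<rangle> = x\<^sup>* S y\<close> both \<open>T\<close> and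
  \<open>I - T = S\<^sup>-\<^sup>1 B\<close> are self-adjoint and positive semi-definite, and
  \<open>(1 + \<i>) G = T + \<i> (I - T)\<close>. Thus \<open>G\<close> is normal and its eigenvalues are
  \<open>(t + \<i> (1 - t)) / (1 + \<i>)\<close> with \<open>0 \<le> t \<le> 1\<close>, of modulus at most \<open>1 / sqrt 2 < 0.8\<close>.
  The same bound follows directly from the inner product: with \<open>\<parallel>y\<parallel>\<^sup>2 = \<langle>y, y\<rangle>\<close>,
  \<open>\<parallel>(T + \<i> (I - T)) x\<parallel>\<^sup>2 = \<parallel>T x\<parallel>\<^sup>2 + \<parallel>(I - T) x\<parallel>\<^sup>2 = \<parallel>x\<parallel>\<^sup>2 - 2 \<langle>T x, (I - T) x\<rangle>\<close>,
  and the last inner product is nonnegative by \<open>energy_split\<close>. The result is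
  \<open>energy_contraction\<close>. Complex vectors are handled there through their real and imaginary parts.
\<close>

section \<open>Operator norms induced by vector norms\<close>

definition vector_norm :: "(complex^'n \<Rightarrow> real) \<Rightarrow> bool" where
  "vector_norm \<nu> \<longleftrightarrow>
     (\<forall>x. 0 \<le> \<nu> x) \<and>
     (\<forall>x. \<nu> x = 0 \<longleftrightarrow> x = 0) \<and>
     (\<forall>c x. \<nu> (c *s x) = cmod c * \<nu> x) \<and>
     (\<forall>x y. \<nu> (x + y) \<le> \<nu> x + \<nu> y)"

lemma vector_norm_nonneg: "vector_norm \<nu> \<Longrightarrow> 0 \<le> \<nu> x"
  and vector_norm_eq_0: "vector_norm \<nu> \<Longrightarrow> \<nu> x = 0 \<longleftrightarrow> x = 0"
  and vector_norm_scale: "vector_norm \<nu> \<Longrightarrow> \<nu> (c *s x) = cmod c * \<nu> x"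
  and vector_norm_triangle: "vector_norm \<nu> \<Longrightarrow> \<nu> (x + y) \<le> \<nu> x + \<nu> y"
  by (simp_all add: vector_norm_def)

lemma vector_norm_zero: "vector_norm \<nu> \<Longrightarrow> \<nu> 0 = 0"
  by (simp add: vector_norm_eq_0)

lemma vector_norm_triangle_diff:
  assumes "vector_norm \<nu>"
  shows "\<nu> (x - y) \<le> \<nu> x + \<nu> y"
proof -
  have "\<nu> ((-1) *s y) = \<nu> y"
    using vector_norm_scale[OF assms, of "-1" y] by simp
  moreover have "x - y = x + (-1) *s y" by (simp add: vec_eq_iff)
  ultimately show ?thesis using vector_norm_triangle[OF assms, of x "(-1) *s y"] by simp
qed

lemma vector_norm_sum:
  assumes "vector_norm \<nu>"
  shows "\<nu> (\<Sum>i\<in>I. f i) \<le> (\<Sum>i\<in>I. \<nu> (f i))"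
proof (induction I rule: infinite_finite_induct)
  case (insert i I)
  then show ?case using vector_norm_triangle[OF assms, of "f i" "sum f I"] by simp
qed (simp_all add: vector_norm_zero[OF assms])

lemma vector_norm_upper:
  fixes \<nu> :: "complex^'n \<Rightarrow> real"
  assumes "vector_norm \<nu>"
  obtains M where "0 \<le> M" "\<And>x. \<nu> x \<le> M * norm x"
proof
  let ?M = "\<Sum>i\<in>UNIV. \<nu> (axis i 1)"
  show "0 \<le> ?M" by (intro sum_nonneg vector_norm_nonneg assms)
  fix x :: "complex^'n"
  have "\<nu> x = \<nu> (\<Sum>i\<in>UNIV. x$i *s axis i 1)" by (simp only: basis_expansion)
  also have "\<dots> \<le> (\<Sum>i\<in>UNIV. \<nu> (x$i *s axis i 1))" by (rule vector_norm_sum[OF assms])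
  also have "\<dots> \<le> (\<Sum>i\<in>UNIV. \<nu> (axis i 1) * norm x)"
    by (intro sum_mono)
      (simp add: vector_norm_scale[OF assms] mult.commute[of "norm x"] mult.commute[of "cmod _"]
        mult_left_mono Finite_Cartesian_Product.norm_nth_le vector_norm_nonneg[OF assms])
  finally show "\<nu> x \<le> ?M * norm x" by (simp add: sum_distrib_right)
qed

lemma vector_norm_continuous:
  assumes "vector_norm \<nu>"
  shows "continuous_on S \<nu>"
proof -
  obtain M where M: "0 \<le> M" "\<And>x. \<nu> x \<le> M * norm x"
    using vector_norm_upper[OF assms] by blast
  have "\<nu> x - \<nu> y \<le> M * dist x y" for x y
    using vector_norm_triangle[OF assms, of "x - y" y] M(2)[of "x - y"] by (simp add: dist_norm)
  then have "dist (\<nu> x) (\<nu> y) \<le> M * dist x y" for x y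
    using abs_le_iff dist_commute dist_real_def by (metis minus_diff_eq)
  then show ?thesis
    using M(1) lipschitz_on_continuous_on lipschitz_onI by metis
qed

lemma scale_of_real: "complex_of_real a *s x = a *\<^sub>R x"
  by (simp add: vec_eq_iff complex_eq_iff)

text \<open>The minimum over the compact Euclidean unit sphere is attained at a nonzero vector, hence is
  positive; homogeneity extends the bound to all vectors.\<close>

lemma vector_norm_lower:
  fixes \<nu> :: "complex^'n \<Rightarrow> real"
  assumes "vector_norm \<nu>"
  obtains m where "0 < m" "\<And>x. m * norm x \<le> \<nu> x"
proof -
  let ?S = "sphere 0 1 :: (complex^'n) set"
  have ne: "?S \<noteq> {}" by simp
  obtain a where a: "a \<in> ?S" "\<And>x. x \<in> ?S \<Longrightarrow> \<nu> a \<le> \<nu> x"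
    using continuous_attains_inf[OF compact_sphere ne vector_norm_continuous[OF assms]] by blast
  have "a \<noteq> 0" using a(1) by auto
  then have "0 < \<nu> a"
    using vector_norm_nonneg[OF assms, of a] vector_norm_eq_0[OF assms, of a] by linarith
  moreover have "\<nu> a * norm x \<le> \<nu> x" for x
  proof (cases "x = 0")
    case False
    let ?y = "complex_of_real (inverse (norm x)) *s x"
    have y: "?y = inverse (norm x) *\<^sub>R x"
      by (rule scale_of_real)
    have "?y \<in> ?S" unfolding y using False by simp
    from a(2)[OF this] have "\<nu> a \<le> inverse (norm x) * \<nu> x"
      unfolding vector_norm_scale[OF assms] by (simp add: norm_inverse)
    then show ?thesis using False by (simp add: field_simps)
  qed (simp add: vector_norm_nonneg[OF assms])
  ultimately show ?thesis using that by blast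
qed

text \<open>At \<open>x = 0\<close> the quotient is \<open>0 / 0 = 0\<close>, which leaves the supremum of nonnegative numbers
  unchanged, so no restriction to nonzero vectors is made.\<close>

definition op_norm :: "(complex^'n \<Rightarrow> real) \<Rightarrow> complex^'n^'n \<Rightarrow> real" where
  "op_norm \<nu> X = (SUP x. \<nu> (X *v x) / \<nu> x)"

lemma op_norm_le:
  assumes "vector_norm \<nu>" "0 \<le> K" "\<And>x. \<nu> (X *v x) \<le> K * \<nu> x"
  shows "op_norm \<nu> X \<le> K"
  unfolding op_norm_def
proof (rule cSUP_least)
  fix x
  show "\<nu> (X *v x) / \<nu> x \<le> K"
    using assms(2) assms(3)[of x] vector_norm_nonneg[OF assms(1), of x]
    by (cases "\<nu> x = 0") (simp_all add: divide_le_eq)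
qed simp

text \<open>The real supremum bounds its quotients only if these are bounded above. They are, because \<open>\<nu>\<close> is equivalent to the Euclidean norm, in which matrices act boundedly.\<close>

lemma op_norm_bound:
  fixes X :: "complex^'n^'n"
  assumes "vector_norm \<nu>"
  shows "\<nu> (X *v x) \<le> op_norm \<nu> X * \<nu> x"
proof (cases "x = 0")
  case False
  obtain M where M: "0 \<le> M" "\<And>x. \<nu> x \<le> M * norm x"
    using vector_norm_upper[OF assms] by blast
  obtain m where m: "0 < m" "\<And>x. m * norm x \<le> \<nu> x"
    using vector_norm_lower[OF assms] by blast
  have "bounded_linear (\<lambda>x. X *v x)"
    by (rule linear_conv_bounded_linear[THEN iffD1]) simp
  then obtain L where L: "0 \<le> L" "\<And>x. norm (X *v x) \<le> norm x * L"
    using bounded_linear.nonneg_bounded by blast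
  have "\<nu> (X *v y) \<le> (M * L / m) * \<nu> y" for y
  proof -
    have "\<nu> (X *v y) \<le> M * (norm y * L)"
      using M(2)[of "X *v y"] mult_left_mono[OF L(2)[of y] M(1)] by linarith
    also have "\<dots> = (M * L / m) * (m * norm y)" using m(1) by simp
    also have "\<dots> \<le> (M * L / m) * \<nu> y"
      using m M(1) L(1) by (intro mult_left_mono) simp_all
    finally show ?thesis .
  qed
  then have "\<nu> (X *v y) / \<nu> y \<le> M * L / m" for y
    using vector_norm_nonneg[OF assms, of y] m(1) M(1) L(1)
    by (cases "\<nu> y = 0") (simp_all add: divide_le_eq)
  then have "bdd_above (range (\<lambda>y. \<nu> (X *v y) / \<nu> y))" by (intro bdd_aboveI2)
  then have "\<nu> (X *v x) / \<nu> x \<le> op_norm \<nu> X"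
    unfolding op_norm_def by (rule cSUP_upper[OF UNIV_I])
  moreover have "0 < \<nu> x"
    using False vector_norm_nonneg[OF assms, of x] vector_norm_eq_0[OF assms, of x] by linarith
  ultimately show ?thesis by (simp add: divide_le_eq)
qed (simp add: vector_norm_zero[OF assms])

lemma cscale_mult_vec: "(c *\<^sub>C X) *v x = c *s (X *v x)"
  by (simp add: cscale_def vec_eq_iff matrix_vector_mult_def sum_distrib_left mult.assoc)

lemma matrix_norm_op_norm:
  fixes \<nu> :: "complex^'n \<Rightarrow> real"
  assumes \<nu>: "vector_norm \<nu>"
  shows "matrix_norm (op_norm \<nu>)"
proof -
  note bound = op_norm_bound[OF \<nu>] and nonneg = vector_norm_nonneg[OF \<nu>]
  have pos: "0 \<le> op_norm \<nu> X" for X :: "complex^'n^'n"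
  proof -
    let ?e = "axis undefined 1 :: complex^'n"
    have "?e \<noteq> 0" by (simp add: axis_eq_0_iff)
    then have "0 < \<nu> ?e"
      using nonneg[of ?e] vector_norm_eq_0[OF \<nu>, of ?e] by linarith
    moreover have "0 \<le> op_norm \<nu> X * \<nu> ?e" using bound[of X ?e] nonneg[of "X *v ?e"] by linarith
    ultimately show ?thesis by (simp add: zero_le_mult_iff)
  qed
  have zero: "op_norm \<nu> X = 0 \<longleftrightarrow> X = 0" for X :: "complex^'n^'n"
  proof
    assume "op_norm \<nu> X = 0"
    then have "X *v x = 0" for x
      using bound[of X x] nonneg[of "X *v x"] vector_norm_eq_0[OF \<nu>, of "X *v x"] by simp
    then show "X = 0" by (simp add: matrix_eq)
  next
    assume "X = 0"
    then have "op_norm \<nu> X \<le> 0" by (intro op_norm_le[OF \<nu>]) (simp_all add: vector_norm_zero[OF \<nu>])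
    then show "op_norm \<nu> X = 0" using pos[of X] by simp
  qed
  have scale_le: "op_norm \<nu> (c *\<^sub>C X) \<le> cmod c * op_norm \<nu> X" for c and X :: "complex^'n^'n"
  proof (rule op_norm_le[OF \<nu>])
    show "\<nu> ((c *\<^sub>C X) *v x) \<le> cmod c * op_norm \<nu> X * \<nu> x" for x
      using mult_left_mono[OF bound[of X x], of "cmod c"]
      by (simp add: cscale_mult_vec vector_norm_scale[OF \<nu>] mult.assoc)
  qed (simp add: pos)
  have scale: "op_norm \<nu> (c *\<^sub>C X) = cmod c * op_norm \<nu> X" for c and X :: "complex^'n^'n"
  proof (cases "c = 0")
    case True
    then show ?thesis using scale_le[of c X] pos[of "c *\<^sub>C X"] by simp
  next
    case False
    have "inverse c *\<^sub>C (c *\<^sub>C X) = X" using False by (simp add: cscale_def vec_eq_iff)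
    then have "op_norm \<nu> X \<le> inverse (cmod c) * op_norm \<nu> (c *\<^sub>C X)"
      using scale_le[of "inverse c" "c *\<^sub>C X"] by (simp add: norm_inverse)
    then have "cmod c * op_norm \<nu> X \<le> op_norm \<nu> (c *\<^sub>C X)"
      using False by (simp add: field_simps)
    then show ?thesis using scale_le[of c X] by linarith
  qed
  have add: "op_norm \<nu> (X + Y) \<le> op_norm \<nu> X + op_norm \<nu> Y" for X Y :: "complex^'n^'n"
  proof (rule op_norm_le[OF \<nu>])
    show "\<nu> ((X + Y) *v x) \<le> (op_norm \<nu> X + op_norm \<nu> Y) * \<nu> x" for x
      using vector_norm_triangle[OF \<nu>, of "X *v x" "Y *v x"] bound[of X x] bound[of Y x]
      by (simp add: matrix_vector_mult_add_rdistrib distrib_right)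
  qed (simp add: pos)
  have mult: "op_norm \<nu> (X ** Y) \<le> op_norm \<nu> X * op_norm \<nu> Y" for X Y :: "complex^'n^'n"
  proof (rule op_norm_le[OF \<nu>])
    show "\<nu> ((X ** Y) *v x) \<le> op_norm \<nu> X * op_norm \<nu> Y * \<nu> x" for x
      using bound[of X "Y *v x"] mult_left_mono[OF bound[of Y x] pos[of X]]
      by (simp add: mult.assoc flip: matrix_vector_mul_assoc)
  qed (simp add: pos)
  show ?thesis unfolding matrix_norm_def using pos zero scale add mult by blast
qed

section \<open>Truncated Neumann series of a contraction\<close>

lemma matrix_inv_right:
  fixes M :: "'a::semiring_1^'n^'m"
  assumes "invertible M"
  shows "M ** matrix_inv M = mat 1"
  using assms someI_ex[of "\<lambda>M'. M ** M' = mat 1 \<and> M' ** M = mat 1"]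
  unfolding invertible_def matrix_inv_def by blast

lemma matrix_inv_left:
  fixes M :: "'a::semiring_1^'n^'m"
  assumes "invertible M"
  shows "matrix_inv M ** M = mat 1"
  using assms someI_ex[of "\<lambda>M'. M ** M' = mat 1 \<and> M' ** M = mat 1"]
  unfolding invertible_def matrix_inv_def by blast

lemma matrix_inv_involution:
  fixes M :: "'a::semiring_1^'n^'m"
  assumes "invertible M"
  shows "invertible (matrix_inv M)" "matrix_inv (matrix_inv M) = M"
proof -
  show inv: "invertible (matrix_inv M)"
    using matrix_inv_right[OF assms] matrix_inv_left[OF assms] unfolding invertible_def by blast
  have "matrix_inv (matrix_inv M) = (M ** matrix_inv M) ** matrix_inv (matrix_inv M)"
    by (simp add: matrix_inv_right[OF assms])
  also have "\<dots> = M" by (simp add: matrix_inv_right[OF inv] flip: matrix_mul_assoc)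
  finally show "matrix_inv (matrix_inv M) = M" .
qed

lemma matpow_commute: "matpow G n ** G = G ** matpow G n"
  by (induction n) (simp_all flip: matrix_mul_assoc)

lemma matrix_add_mult:
  fixes X Y :: "'a::semiring_1^'n^'m" and Z :: "'a^'p^'n"
  shows "(X + Y) ** Z = X ** Z + Y ** Z"
  by (simp add: vec_eq_iff matrix_matrix_mult_def distrib_right sum.distrib)

lemma matrix_mult_diff:
  fixes X :: "'a::ring_1^'n^'m" and Y Z :: "'a^'p^'n"
  shows "X ** (Y - Z) = X ** Y - X ** Z"
  by (simp add: vec_eq_iff matrix_matrix_mult_def right_diff_distrib sum_subtractf)

lemma neumann_telescope:
  fixes G :: "complex^'n^'n"
  shows "(\<Sum>k<n. matpow G k) ** (mat 1 - G) = mat 1 - matpow G n"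
proof (induction n)
  case 0
  show ?case by (simp add: vec_eq_iff matrix_matrix_mult_def)
next
  case (Suc n)
  have "(\<Sum>k<Suc n. matpow G k) ** (mat 1 - G)
      = (\<Sum>k<n. matpow G k) ** (mat 1 - G) + matpow G n ** (mat 1 - G)"
    by (simp add: matrix_add_mult)
  also have "\<dots> = mat 1 - matpow G (Suc n)"
    unfolding Suc by (simp add: matrix_mult_diff matpow_commute)
  finally show ?case .
qed

text \<open>Since \<open>P\<^sup>-\<^sup>1 (P - Q) = I - G\<close> for \<open>G = P\<^sup>-\<^sup>1 Q\<close>, the product telescopes.\<close>

lemma neumann_sum_mult:
  fixes P Q :: "complex^'n^'n"
  assumes "invertible P"
  shows "neumann_sum P Q n ** (P - Q) = mat 1 - matpow (matrix_inv P ** Q) n"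
  unfolding neumann_sum_def
  using neumann_telescope[where n = n and G = "matrix_inv P ** Q"]
  by (simp add: matrix_mult_diff matrix_inv_left[OF assms] flip: matrix_mul_assoc)

lemma matpow_contraction:
  fixes G :: "complex^'n^'n" and \<nu> :: "complex^'n \<Rightarrow> real"
  assumes "0 \<le> r" "\<And>x. \<nu> (G *v x) \<le> r * \<nu> x"
  shows "\<nu> (matpow G n *v x) \<le> r ^ n * \<nu> x"
proof (induction n)
  case (Suc n)
  have "\<nu> (G *v (matpow G n *v x)) \<le> r * (r ^ n * \<nu> x)"
    using assms(2)[of "matpow G n *v x"] mult_left_mono[OF Suc assms(1)] by linarith
  then show ?case by (simp add: matrix_vector_mul_assoc mult.assoc)
qed simp

text \<open>Both bounds come from the triangle inequality around \<open>x = (x - H x) + H x\<close>: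
  \<open>(1 - s) \<nu> x \<le> \<nu> (x - H x) \<le> (1 + s) \<nu> x\<close>. The left one gives injectivity, and
  applied to the preimage of \<open>x\<close> under \<open>I - H\<close> it bounds the inverse.\<close>

lemma near_identity:
  fixes H :: "complex^'n^'n"
  assumes \<nu>: "vector_norm \<nu>" and s: "0 \<le> s" "s < 1" and H: "\<And>x. \<nu> (H *v x) \<le> s * \<nu> x"
  shows "invertible (mat 1 - H)" "cond_num (op_norm \<nu>) (mat 1 - H) \<le> (1 + s) / (1 - s)"
proof -
  let ?M = "mat 1 - H"
  have Mx: "?M *v x = x - H *v x" for x
    by (simp add: matrix_vector_mult_diff_rdistrib)
  have up: "\<nu> (?M *v x) \<le> (1 + s) * \<nu> x" for x
    using vector_norm_triangle_diff[OF \<nu>, of x "H *v x"] H[of x]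
    by (simp add: Mx distrib_right)
  have low: "(1 - s) * \<nu> x \<le> \<nu> (?M *v x)" for x
    using vector_norm_triangle[OF \<nu>, of "?M *v x" "H *v x"] H[of x]
    by (simp add: Mx left_diff_distrib)
  have "x = y" if "?M *v x = ?M *v y" for x y
  proof -
    have "?M *v (x - y) = 0" using that by (simp add: matrix_vector_mult_diff_distrib)
    then have "(1 - s) * \<nu> (x - y) \<le> 0"
      using low[of "x - y"] by (simp add: vector_norm_zero[OF \<nu>])
    then have "\<nu> (x - y) = 0"
      using s(2) vector_norm_nonneg[OF \<nu>, of "x - y"] by (simp add: mult_le_0_iff)
    then show "x = y" by (simp add: vector_norm_eq_0[OF \<nu>])
  qed
  then have "inj ((*v) ?M)" by (rule injI)
  then show inv: "invertible ?M"
    by (simp add: invertible_left_inverse matrix_left_invertible_injective)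
  have "op_norm \<nu> ?M \<le> 1 + s" by (rule op_norm_le[OF \<nu> _ up]) (use s in simp)
  moreover have "op_norm \<nu> (matrix_inv ?M) \<le> 1 / (1 - s)"
  proof (rule op_norm_le[OF \<nu>])
    show "\<nu> (matrix_inv ?M *v x) \<le> 1 / (1 - s) * \<nu> x" for x
      using low[of "matrix_inv ?M *v x"] s(2)
      by (simp add: matrix_vector_mul_assoc matrix_inv_right[OF inv] field_simps)
  qed (use s in simp)
  moreover have "0 \<le> op_norm \<nu> (matrix_inv ?M)"
    using matrix_norm_op_norm[OF \<nu>] unfolding matrix_norm_def by blast
  ultimately have "op_norm \<nu> ?M * op_norm \<nu> (matrix_inv ?M) \<le> (1 + s) * (1 / (1 - s))"
    using s by (intro mult_mono) simp_all
  then show "cond_num (op_norm \<nu>) ?M \<le> (1 + s) / (1 - s)" by (simp add: cond_num_def)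
qed

section \<open>The energy norm\<close>

definition re_vec :: "complex^'n \<Rightarrow> real^'n" where
  "re_vec x = (\<chi> i. Re (x $ i))"

definition im_vec :: "complex^'n \<Rightarrow> real^'n" where
  "im_vec x = (\<chi> i. Im (x $ i))"

lemma re_im_vec_eq_0: "x = 0 \<longleftrightarrow> re_vec x = 0 \<and> im_vec x = 0"
  by (auto simp: vec_eq_iff complex_eq_iff re_vec_def im_vec_def)

lemma re_im_vec_add:
  "re_vec (x + y) = re_vec x + re_vec y" "im_vec (x + y) = im_vec x + im_vec y"
  by (simp_all add: vec_eq_iff re_vec_def im_vec_def)

lemma re_im_vec_scaleR:
  "re_vec (a *\<^sub>R x) = a *\<^sub>R re_vec x" "im_vec (a *\<^sub>R x) = a *\<^sub>R im_vec x"
  by (simp_all add: vec_eq_iff re_vec_def im_vec_def)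

lemma re_im_vec_scale:
  "re_vec (c *s x) = Re c *\<^sub>R re_vec x - Im c *\<^sub>R im_vec x"
  "im_vec (c *s x) = Re c *\<^sub>R im_vec x + Im c *\<^sub>R re_vec x"
  by (simp_all add: vec_eq_iff re_vec_def im_vec_def)

lemma re_im_vec_cmat:
  "re_vec (cmat M *v x) = M *v re_vec x" "im_vec (cmat M *v x) = M *v im_vec x"
  by (simp_all add: vec_eq_iff re_vec_def im_vec_def cmat_def matrix_vector_mult_def)

lemma symmetric_inner_swap:
  fixes M :: "real^'n^'n"
  assumes "transpose M = M"
  shows "x \<bullet> (M *v y) = y \<bullet> (M *v x)"
proof -
  have "x \<bullet> (M *v y) = (x v* M) \<bullet> y" by (simp only: dot_lmul_matrix)
  also have "x v* M = M *v x" using transpose_matrix_vector[of M x] assms by simp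
  finally show ?thesis by (simp add: inner_commute)
qed

text \<open>The triangle inequality for the norm of an arbitrary inner product, by way of
  Cauchy-Schwarz.\<close>

lemma bilinear_form_triangle:
  fixes f :: "'a::real_vector \<Rightarrow> 'a \<Rightarrow> real"
  assumes bil: "bilinear f" and sym: "\<And>x y. f x y = f y x" and pos: "\<And>x. x \<noteq> 0 \<Longrightarrow> 0 < f x x"
  shows "sqrt (f (x + y) (x + y)) \<le> sqrt (f x x) + sqrt (f y y)"
proof -
  note lin = bilinear_ladd[OF bil] bilinear_radd[OF bil] bilinear_lsub[OF bil] bilinear_rsub[OF bil]
    bilinear_lmul[OF bil] bilinear_rmul[OF bil] bilinear_lzero[OF bil] bilinear_rzero[OF bil]
  have nonneg: "0 \<le> f z z" for z
    using pos[of z] by (cases "z = 0") (simp_all add: lin)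
  have cs: "(f x y)\<^sup>2 \<le> f x x * f y y"
  proof (cases "y = 0")
    case False
    \<comment> \<open>\<open>?t *\<^sub>R y\<close> is the orthogonal projection of \<open>x\<close> onto the line through \<open>y\<close>.\<close>
    let ?t = "f x y / f y y"
    have y: "0 < f y y" using pos False by simp
    have "0 \<le> f (x - ?t *\<^sub>R y) (x - ?t *\<^sub>R y)" by (rule nonneg)
    also have "\<dots> = f x x - (f x y)\<^sup>2 / f y y"
      using y by (simp add: lin sym[of y x] power2_eq_square)
    finally show ?thesis using y by (simp add: field_simps)
  qed (simp add: lin)
  have "f x y \<le> sqrt (f x x) * sqrt (f y y)"
    using real_le_rsqrt[OF cs] by (simp add: real_sqrt_mult)
  then have "f (x + y) (x + y) \<le> (sqrt (f x x) + sqrt (f y y))\<^sup>2"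
    by (simp add: lin sym[of y x] power2_sum nonneg)
  then show ?thesis by (intro real_le_lsqrt add_nonneg_nonneg) (simp_all add: nonneg)
qed

text \<open>The real part of the Hermitian form \<open>x\<^sup>* S y\<close>. On the diagonal \<open>x = y\<close> the two
  agree when \<open>S\<close> is symmetric, so the real form already gives the norm.\<close>

definition energy_form :: "real^'n^'n \<Rightarrow> complex^'n \<Rightarrow> complex^'n \<Rightarrow> real" where
  "energy_form S x y = re_vec x \<bullet> (S *v re_vec y) + im_vec x \<bullet> (S *v im_vec y)"

definition energy_norm :: "real^'n^'n \<Rightarrow> complex^'n \<Rightarrow> real" where
  "energy_norm S x = sqrt (energy_form S x x)"

lemma vector_norm_energy_norm:
  fixes S :: "real^'n^'n"
  assumes "pos_def S"
  shows "vector_norm (energy_norm S)"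
proof -
  have S: "transpose S = S" "\<And>u. u \<noteq> 0 \<Longrightarrow> 0 < u \<bullet> (S *v u)"
    using assms by (simp_all add: pos_def_def)
  have S0: "0 \<le> u \<bullet> (S *v u)" for u
    using S(2)[of u] by (cases "u = 0") simp_all
  have bil: "bilinear (energy_form S)"
    unfolding bilinear_def energy_form_def
    by (auto intro!: linearI simp: re_im_vec_add re_im_vec_scaleR matrix_vector_right_distrib
        inner_add_left inner_add_right matrix_vector_mult_scaleR distrib_left)
  have sym: "energy_form S x y = energy_form S y x" for x y
    unfolding energy_form_def using symmetric_inner_swap[OF S(1)] by simp
  have pos: "0 < energy_form S x x" if "x \<noteq> 0" for x
  proof (cases "re_vec x = 0")
    case True
    then have "im_vec x \<noteq> 0" using that re_im_vec_eq_0 by blast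
    then show ?thesis using True S(2) by (simp add: energy_form_def)
  next
    case False
    then show ?thesis using S(2) S0 by (simp add: energy_form_def add_pos_nonneg)
  qed
  have zero: "energy_form S 0 0 = 0" using bilinear_lzero[OF bil] .
  have nonneg: "0 \<le> energy_form S x x" for x
    using pos[of x] zero by (cases "x = 0") simp_all
  have scale: "energy_form S (c *s x) (c *s x) = (cmod c)\<^sup>2 * energy_form S x x" for c x
    using symmetric_inner_swap[OF S(1), of "im_vec x" "re_vec x"]
    unfolding energy_form_def re_im_vec_scale cmod_power2
    by (simp add: matrix_vector_right_distrib matrix_vector_mult_diff_distrib
        matrix_vector_mult_scaleR inner_add_left inner_add_right inner_diff_left inner_diff_right
        power2_eq_square algebra_simps)
  show ?thesis
    unfolding vector_norm_def energy_norm_def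
  proof (intro conjI allI)
    fix x y :: "complex^'n" and c
    show "sqrt (energy_form S x x) = 0 \<longleftrightarrow> x = 0"
      using pos[of x] zero by (cases "x = 0") auto
    show "sqrt (energy_form S (c *s x) (c *s x)) = cmod c * sqrt (energy_form S x x)"
      by (simp add: scale real_sqrt_mult)
    show "sqrt (energy_form S (x + y) (x + y))
        \<le> sqrt (energy_form S x x) + sqrt (energy_form S y y)"
      by (rule bilinear_form_triangle[OF bil sym pos])
  qed (simp add: nonneg)
qed

section \<open>Contraction in the energy norm\<close>

text \<open>With \<open>S = B + C\<close>, \<open>T = S\<^sup>-\<^sup>1 C\<close> and \<open>p = T u\<close>, the claim says that the energy inner
  product of \<open>T u\<close> and \<open>(I - T) u\<close> is nonnegative. The operator behind it is a product of two
  commuting positive ones, and \<open>T (I - T) = T (I - T) T + (I - T) T (I - T)\<close> shows its positivity: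
  the two summands give the quadratic forms of \<open>B\<close> at \<open>T u\<close> and of \<open>C\<close> at \<open>(I - T) u\<close>.\<close>

lemma energy_split:
  fixes B C :: "real^'n^'n"
  assumes B: "pos_semidef B" and C: "pos_semidef C" and p: "(B + C) *v p = C *v u"
  shows "p \<bullet> ((B + C) *v p) + (u - p) \<bullet> ((B + C) *v (u - p)) \<le> u \<bullet> ((B + C) *v u)"
proof -
  let ?S = "B + C" and ?z = "u - p"
  have tB: "transpose B = B" and tC: "transpose C = C" and pB: "0 \<le> p \<bullet> (B *v p)"
    and zC: "0 \<le> ?z \<bullet> (C *v ?z)"
    using B C by (simp_all add: pos_semidef_def)
  note dist = matrix_vector_right_distrib matrix_vector_mult_diff_distrib
    matrix_vector_mult_add_rdistrib inner_add_left inner_add_right inner_diff_left inner_diff_right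
  note swap = symmetric_inner_swap[OF tB, of u p] symmetric_inner_swap[OF tC, of u p]
  have "p \<bullet> (?S *v p) = p \<bullet> (C *v u)" "u \<bullet> (?S *v p) = u \<bullet> (C *v u)"
    using p by simp_all
  then have "p \<bullet> (?S *v ?z) = p \<bullet> (B *v p) + ?z \<bullet> (C *v ?z)"
    using swap by (simp add: dist)
  then have "0 \<le> p \<bullet> (?S *v ?z)" using pB zC by simp
  then show ?thesis using swap by (simp add: dist)
qed

text \<open>The equation says \<open>y = G x\<close>. With \<open>y = a + \<i> b\<close>, multiplication by \<open>1 + \<i>\<close> turns \<open>(a, b)\<close>
  into \<open>(a - b, a + b)\<close>, which doubles the energy by the parallelogram law; this is the source of
  the factor \<open>1 / 2\<close>. The remaining operator \<open>T + \<i> (I - T)\<close> does not increase the energy, since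
  the mixed terms between \<open>T\<close> and \<open>I - T\<close> cancel by symmetry and \<open>energy_split\<close> bounds the rest.\<close>

lemma energy_contraction:
  fixes B C :: "real^'n^'n"
  assumes B: "pos_semidef B" and C: "pos_semidef C" and S: "pos_def (B + C)"
    and eq: "((1 + \<i>) *\<^sub>C cmat (B + C)) *v y = (cmat C + \<i> *\<^sub>C cmat B) *v x"
  shows "energy_form (B + C) y y \<le> energy_form (B + C) x x / 2"
proof -
  let ?S = "B + C"
  define a b u v where "a = re_vec y" "b = im_vec y" "u = re_vec x" "v = im_vec x"
  have tS: "transpose ?S = ?S" using S by (simp add: pos_def_def)
  have inj: "w = w'" if "?S *v w = ?S *v w'" for w w'
  proof (rule ccontr)
    assume "w \<noteq> w'"
    then have "0 < (w - w') \<bullet> (?S *v (w - w'))" using S by (simp add: pos_def_def)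
    then show False using that by (simp add: matrix_vector_mult_diff_distrib)
  qed
  have "inj ((*v) ?S)" using inj by (rule injI)
  then have "surj ((*v) ?S)" using linear_injective_imp_surjective[of "(*v) ?S"] by simp
  \<comment> \<open>\<open>p = T u\<close> and \<open>q = T v\<close>, where \<open>T = S\<^sup>-\<^sup>1 C\<close>.\<close>
  then obtain p q where p: "?S *v p = C *v u" and q: "?S *v q = C *v v" by (metis surjD)
  have Bu: "B *v w = ?S *v w - C *v w" for w by (simp add: matrix_vector_mult_add_rdistrib)
  have "?S *v (a - b) = C *v u - B *v v" "?S *v (a + b) = C *v v + B *v u"
    using arg_cong[OF eq, of re_vec] arg_cong[OF eq, of im_vec]
    unfolding a_b_u_v_def
    by (simp_all add: cscale_mult_vec matrix_vector_mult_add_rdistrib re_im_vec_add re_im_vec_scale re_im_vec_cmat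
        algebra_simps)
  then have "?S *v (a - b) = ?S *v (p - (v - q))" "?S *v (a + b) = ?S *v (q + (u - p))"
    unfolding Bu by (simp_all add: matrix_vector_right_distrib matrix_vector_mult_diff_distrib p q)
  then have ab: "a - b = p - (v - q)" "a + b = q + (u - p)" by (blast dest: inj)+
  note dist = matrix_vector_right_distrib matrix_vector_mult_diff_distrib
    inner_add_left inner_add_right inner_diff_left inner_diff_right
  let ?q = "\<lambda>w. w \<bullet> (?S *v w)"
  have par: "2 * (?q a + ?q b) = ?q (a - b) + ?q (a + b)"
    by (simp add: dist)
  \<comment> \<open>\<open>T\<close> is self-adjoint in the energy inner product.\<close>
  have cross: "p \<bullet> (?S *v v) = u \<bullet> (?S *v q)"
  proof -
    have "p \<bullet> (?S *v v) = v \<bullet> (C *v u)" using symmetric_inner_swap[OF tS, of p v] p by simp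
    also have "\<dots> = u \<bullet> (?S *v q)"
      using symmetric_inner_swap[of C v u] C q by (simp add: pos_semidef_def)
    finally show ?thesis .
  qed
  have "?q (p - (v - q)) + ?q (q + (u - p)) = ?q p + ?q (u - p) + (?q q + ?q (v - q))"
    using cross symmetric_inner_swap[OF tS, of p v] symmetric_inner_swap[OF tS, of p q]
      symmetric_inner_swap[OF tS, of u q] symmetric_inner_swap[OF tS, of v q]
      symmetric_inner_swap[OF tS, of u p]
    unfolding dist by linarith
  also have "\<dots> \<le> ?q u + ?q v"
    using energy_split[OF B C p] energy_split[OF B C q] by linarith
  finally have "2 * (?q a + ?q b) \<le> ?q u + ?q v" unfolding par ab .
  then show ?thesis unfolding energy_form_def a_b_u_v_def by simp
qed

text \<open>A real matrix acts on real and imaginary parts separately, so the kernel of \<open>S\<close> stays trivial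
  over the complex numbers.\<close>

lemma invertible_shifted:
  fixes S :: "real^'n^'n"
  assumes "pos_def S"
  shows "invertible ((1 + \<i>) *\<^sub>C cmat S)"
proof -
  let ?P = "(1 + \<i>) *\<^sub>C cmat S"
  have S: "w = 0" if "S *v w = 0" for w
    using assms that unfolding pos_def_def by force
  have ker: "x = 0" if "?P *v x = 0" for x
  proof -
    have "(1 + \<i>) *s (cmat S *v x) = 0" using that by (simp add: cscale_mult_vec)
    moreover have "1 + \<i> \<noteq> 0" by (simp add: complex_eq_iff)
    ultimately have "cmat S *v x = 0" by (simp only: vector_mul_eq_0) simp
    then have "S *v re_vec x = 0" "S *v im_vec x = 0"
      using re_im_vec_cmat[of S x] re_im_vec_eq_0[of "cmat S *v x"] by simp_all
    then show "x = 0" using S re_im_vec_eq_0 by blast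
  qed
  have "inj ((*v) ?P)"
  proof (rule injI)
    fix x y assume "?P *v x = ?P *v y"
    then have "?P *v (x - y) = 0" by (simp add: matrix_vector_mult_diff_distrib)
    then show "x = y" using ker[of "x - y"] by simp
  qed
  then show ?thesis by (simp add: invertible_left_inverse matrix_left_invertible_injective)
qed

theorem corollary2p2:
  fixes B C :: "real^'n^'n" and A P Q :: "complex^'n^'n"
  assumes "pos_semidef B" and "pos_semidef C" and "pos_def (B + C)"
    and "A = cmat B + \<i> *\<^sub>C cmat C"
    and "P = (1 + \<i>) *\<^sub>C cmat (B + C)"
    and "Q = cmat C + \<i> *\<^sub>C cmat B"
  shows "A = P - Q \<and> invertible P \<and>
    (\<forall>n\<ge>1. invertible (precond P Q n) \<and>
            matrix_inv (precond P Q n) = neumann_sum P Q n \<and>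
            invertible (matrix_inv (precond P Q n) ** A)) \<and>
    (\<exists>N. matrix_norm N \<and>
       (\<forall>n\<ge>1. cond_num N (matrix_inv (precond P Q n) ** A) \<le> (1 + 0.8 ^ n) / (1 - 0.8 ^ n) \<and>
               (1 + 0.8 ^ n) / (1 - 0.8 ^ n) \<le> (9 :: real)))"
proof -
  let ?\<nu> = "energy_norm (B + C)" and ?G = "matrix_inv P ** Q"
  have A: "A = P - Q"
    by (simp add: assms(4-6) vec_eq_iff cscale_def cmat_def algebra_simps)
  have P: "invertible P" unfolding assms(5) by (rule invertible_shifted[OF assms(3)])
  have \<nu>: "vector_norm ?\<nu>" by (rule vector_norm_energy_norm[OF assms(3)])
  have contr: "?\<nu> (?G *v x) \<le> 0.8 * ?\<nu> x" for x
  proof -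
    have "P *v (?G *v x) = Q *v x"
      by (simp add: matrix_vector_mul_assoc matrix_mul_assoc matrix_inv_right[OF P])
    then have "energy_form (B + C) (?G *v x) (?G *v x) \<le> energy_form (B + C) x x / 2"
      using energy_contraction[OF assms(1-3)] unfolding assms(5,6) by blast
    \<comment> \<open>\<open>G\<close> contracts even by \<open>1 / sqrt 2\<close>, and \<open>1 / 2 \<le> 0.64 = 0.8\<^sup>2\<close>.\<close>
    also have "\<dots> \<le> 0.8\<^sup>2 * energy_form (B + C) x x"
      using vector_norm_nonneg[OF \<nu>, of x] by (simp add: energy_norm_def power2_eq_square)
    finally have "?\<nu> (?G *v x) \<le> sqrt (0.8\<^sup>2 * energy_form (B + C) x x)"
      unfolding energy_norm_def by (rule real_sqrt_le_mono)
    also have "\<dots> = 0.8 * ?\<nu> x" unfolding real_sqrt_mult energy_norm_def by simp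
    finally show ?thesis .
  qed
  have prod: "neumann_sum P Q n ** A = mat 1 - matpow ?G n" for n
    unfolding A by (rule neumann_sum_mult[OF P])
  have pow: "?\<nu> (matpow ?G n *v x) \<le> 0.8 ^ n * ?\<nu> x" for n x
    by (rule matpow_contraction[where \<nu> = ?\<nu>, OF _ contr]) simp
  have main: "invertible (precond P Q n) \<and> matrix_inv (precond P Q n) = neumann_sum P Q n \<and>
      invertible (matrix_inv (precond P Q n) ** A) \<and>
      cond_num (op_norm ?\<nu>) (matrix_inv (precond P Q n) ** A) \<le> (1 + 0.8 ^ n) / (1 - 0.8 ^ n) \<and>
      (1 + 0.8 ^ n) / (1 - 0.8 ^ n) \<le> (9 :: real)" if "1 \<le> n" for n
  proof -
    \<comment> \<open>The bound is largest at \<open>n = 1\<close>, where it is \<open>1.8 / 0.2 = 9\<close>.\<close>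
    have le: "(0.8 :: real) ^ n \<le> 0.8" using power_decreasing[OF that, of "0.8 :: real"] by simp
    then have lt: "(0.8 :: real) ^ n < 1" by simp
    have inv: "invertible (neumann_sum P Q n ** A)"
      unfolding prod by (rule near_identity(1)[OF \<nu> _ lt pow]) simp
    have cond: "cond_num (op_norm ?\<nu>) (neumann_sum P Q n ** A) \<le> (1 + 0.8 ^ n) / (1 - 0.8 ^ n)"
      unfolding prod by (rule near_identity(2)[OF \<nu> _ lt pow]) simp
    have "invertible (neumann_sum P Q n)"
      using inv unfolding invertible_right_inverse by (metis matrix_mul_assoc)
    note inv_sum = matrix_inv_involution[OF this, folded precond_def]
    have "(1 + 0.8 ^ n) / (1 - 0.8 ^ n) \<le> (9 :: real)"
      using le by (simp add: divide_le_eq)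
    then show ?thesis using inv_sum inv cond by simp
  qed
  then show ?thesis using A P matrix_norm_op_norm[OF \<nu>] by blast
qed

end
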